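(* Let $(X_1,d_1)$ and $(X_2,d_2)$ be Gromov hyperbolic metric spaces with nonempty boundaries at infinity. For $i=1,2$ let $u_i\in\partial_\infty X_i$, let $\gamma_i:[0,\infty)\to X_i$ be a rough geodesic ray converging to $u_i$, and let $B_i:X_i\to\mathbb{R}$ be the Busemann function associated to $\gamma_i$. For $\Delta\ge 0$ let $$Y_\Delta:=\{(x_1,x_2)\in X_1\times X_2 \;:\; |B_1(x_1)-B_2(x_2)|\le\Delta\}$$ and let $d_m\big((x_1,x_2),(x_1',x_2')\big):=\max\{d_1(x_1,x_1'),d_2(x_2,x_2')\}$ on $X_1\times X_2$. Then, for all $\Delta\ge 0$, $(Y_\Delta,d_m|_{Y_\Delta\times Y_\Delta})$ is Gromov hyperbolic.
   Context: Gromov hyperbolicity: a metric space $(X,d)$ is $\delta$-hyperbolic ($\delta\ge 0$) if for all $x,y,z,w\in X$: $d(x,y)+d(z,w)\le \max\{d(x,z)+d(y,w),d(x,w)+d(y,z)\}+2\delta$; it is Gromov hyperbolic if it is $\delta$-hyperbolic for some $\delta\ge 0$. Boundary at infinity: let $(X,d)$ be Gromov hyperbolic, $z\in X$ a basepoint, and $(x\cdot y)_z:=\frac12[d(x,z)+d(y,z)-d(x,y)]$. A sequence $\{x^i\}$ in $X$ converges to infinity if $\liminf_{i,j\to\infty}(x^i\cdot x^j)_z=\infty$; two such sequences $\{x^i\},\{y^i\}$ are equivalent if $\liminf_{i,j\to\infty}(x^i\cdot y^j)_z=\infty$. $\partial_\infty X$ is the set of equivalence classes $[\{x^i\}]$.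 Rough geodesic rays and Busemann functions: a rough geodesic ray is a (not necessarily continuous) map $\gamma:[0,\infty)\to X$ for which there is $k\ge 0$ with $|s-t|-k\le d(\gamma(s),\gamma(t))\le|s-t|+k$ for all $s,t\ge 0$. It converges to $u\in\partial_\infty X$ if $[\{\gamma(i)\}_{i\in\mathbb{N}}]=u$. The Busemann function associated to $\gamma$ is $B_\gamma:X\to\mathbb{R}$, $B_\gamma(x):=\liminf_{t\to\infty}\big[d(x,\gamma(t))-t\big]$. *)

theory Defs
  imports "HOL-Analysis.Analysis"
begin

text \<open>A metric space is a carrier set \<open>M\<close> together with a distance function \<open>d\<close>, as in
  \<^locale>\<open>Metric_space\<close>.\<close>

definition delta_hyperbolic :: "'a set \<Rightarrow> ('a \<Rightarrow> 'a \<Rightarrow> real) \<Rightarrow> real \<Rightarrow> bool" where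
  "delta_hyperbolic M d \<delta> \<longleftrightarrow>
     (\<forall>x\<in>M. \<forall>y\<in>M. \<forall>z\<in>M. \<forall>w\<in>M.
        d x y + d z w \<le> max (d x z + d y w) (d x w + d y z) + 2 * \<delta>)"

definition gromov_hyperbolic :: "'a set \<Rightarrow> ('a \<Rightarrow> 'a \<Rightarrow> real) \<Rightarrow> bool" where
  "gromov_hyperbolic M d \<longleftrightarrow> Metric_space M d \<and> (\<exists>\<delta>\<ge>0. delta_hyperbolic M d \<delta>)"

definition gromov_product :: "('a \<Rightarrow> 'a \<Rightarrow> real) \<Rightarrow> 'a \<Rightarrow> 'a \<Rightarrow> 'a \<Rightarrow> real" where
  "gromov_product d z x y = (d x z + d y z - d x y) / 2"

text \<open>The double lower limit \<open>liminf\<^sub>i\<^sub>,\<^sub>j\<^sub>\<rightarrow>\<^sub>\<infinity>\<close>, with both indices tending to infinity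
  independently, is the lower limit along the product filter; it takes extended real values.\<close>

definition liminf_gromov_product ::
    "('a \<Rightarrow> 'a \<Rightarrow> real) \<Rightarrow> 'a \<Rightarrow> (nat \<Rightarrow> 'a) \<Rightarrow> (nat \<Rightarrow> 'a) \<Rightarrow> ereal" where
  "liminf_gromov_product d z x y =
     Liminf (sequentially \<times>\<^sub>F sequentially) (\<lambda>(i, j). ereal (gromov_product d z (x i) (y j)))"

definition converges_to_infinity ::
    "'a set \<Rightarrow> ('a \<Rightarrow> 'a \<Rightarrow> real) \<Rightarrow> 'a \<Rightarrow> (nat \<Rightarrow> 'a) \<Rightarrow> bool" where
  "converges_to_infinity M d z x \<longleftrightarrow> range x \<subseteq> M \<and> liminf_gromov_product d z x x = \<infinity>"

definition infinity_equiv ::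
    "'a set \<Rightarrow> ('a \<Rightarrow> 'a \<Rightarrow> real) \<Rightarrow> 'a \<Rightarrow> ((nat \<Rightarrow> 'a) \<times> (nat \<Rightarrow> 'a)) set" where
  "infinity_equiv M d z =
     {(x, y). converges_to_infinity M d z x \<and> converges_to_infinity M d z y \<and>
              liminf_gromov_product d z x y = \<infinity>}"

text \<open>The basepoint \<open>z\<close> is an explicit parameter; for Gromov hyperbolic spaces the boundary
  does not depend on the choice of \<open>z \<in> M\<close>.\<close>

definition boundary_at_infinity ::
    "'a set \<Rightarrow> ('a \<Rightarrow> 'a \<Rightarrow> real) \<Rightarrow> 'a \<Rightarrow> (nat \<Rightarrow> 'a) set set" where
  "boundary_at_infinity M d z = {x. converges_to_infinity M d z x} // infinity_equiv M d z"

text \<open>Rays are represented by functions on all reals; their values at negative arguments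
  are irrelevant.\<close>

definition rough_geodesic_ray :: "'a set \<Rightarrow> ('a \<Rightarrow> 'a \<Rightarrow> real) \<Rightarrow> (real \<Rightarrow> 'a) \<Rightarrow> bool" where
  "rough_geodesic_ray M d \<gamma> \<longleftrightarrow>
     \<gamma> \<in> {0..} \<rightarrow> M \<and>
     (\<exists>k\<ge>0. \<forall>s\<ge>0. \<forall>t\<ge>0.
        \<bar>s - t\<bar> - k \<le> d (\<gamma> s) (\<gamma> t) \<and> d (\<gamma> s) (\<gamma> t) \<le> \<bar>s - t\<bar> + k)"

definition ray_converges_to ::
    "'a set \<Rightarrow> ('a \<Rightarrow> 'a \<Rightarrow> real) \<Rightarrow> 'a \<Rightarrow> (real \<Rightarrow> 'a) \<Rightarrow> (nat \<Rightarrow> 'a) set \<Rightarrow> bool" where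
  "ray_converges_to M d z \<gamma> u \<longleftrightarrow>
     converges_to_infinity M d z (\<lambda>i. \<gamma> (real i)) \<and>
     infinity_equiv M d z `` {\<lambda>i. \<gamma> (real i)} = u"

text \<open>The lower limit is taken in the extended reals; along a rough geodesic ray it is finite
  (see \<open>ereal_busemann\<close>), so the conversion to \<open>real\<close> loses nothing.\<close>

definition busemann :: "('a \<Rightarrow> 'a \<Rightarrow> real) \<Rightarrow> (real \<Rightarrow> 'a) \<Rightarrow> 'a \<Rightarrow> real" where
  "busemann d \<gamma> x = real_of_ereal (Liminf at_top (\<lambda>t. ereal (d x (\<gamma> t) - t)))"

lemma ereal_busemann:
  assumes "Metric_space M d" "rough_geodesic_ray M d \<gamma>" "x \<in> M"
  shows "ereal (busemann d \<gamma> x) = Liminf at_top (\<lambda>t. ereal (d x (\<gamma> t) - t))"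
proof -
  interpret Metric_space M d by fact
  obtain k where M: "\<And>t. t \<ge> 0 \<Longrightarrow> \<gamma> t \<in> M"
    and k: "\<And>t. t \<ge> 0 \<Longrightarrow> t - k \<le> d (\<gamma> 0) (\<gamma> t) \<and> d (\<gamma> 0) (\<gamma> t) \<le> t + k"
    using assms(2) unfolding rough_geodesic_ray_def by (fastforce simp: Pi_iff)
  define c where "c = d x (\<gamma> 0) + k"
  have bnd: "- c \<le> d x (\<gamma> t) - t \<and> d x (\<gamma> t) - t \<le> c" if "t \<ge> 0" for t
    using k[OF that] triangle[OF assms(3) M[of 0] M[OF that]]
      triangle[OF M[of 0] assms(3) M[OF that]] commute[of x "\<gamma> 0"]
    by (simp add: c_def)
  let ?L = "Liminf at_top (\<lambda>t. ereal (d x (\<gamma> t) - t))"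
  have "ereal (- c) \<le> ?L"
    by (rule Liminf_bounded) (use bnd in \<open>auto intro: eventually_mono[OF eventually_ge_at_top[of 0]]\<close>)
  moreover have "?L \<le> ereal c"
  proof -
    have "?L \<le> Limsup at_top (\<lambda>t. ereal (d x (\<gamma> t) - t))"
      by (rule Liminf_le_Limsup) simp
    also have "\<dots> \<le> ereal c"
      by (rule Limsup_bounded) (use bnd in \<open>auto intro: eventually_mono[OF eventually_ge_at_top[of 0]]\<close>)
    finally show ?thesis .
  qed
  ultimately have "\<bar>?L\<bar> \<noteq> \<infinity>" by auto
  then show ?thesis by (simp add: busemann_def ereal_real')
qed

definition max_dist ::
    "('a \<Rightarrow> 'a \<Rightarrow> real) \<Rightarrow> ('b \<Rightarrow> 'b \<Rightarrow> real) \<Rightarrow> 'a \<times> 'b \<Rightarrow> 'a \<times> 'b \<Rightarrow> real" where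
  "max_dist d1 d2 = (\<lambda>(x1, x2) (y1, y2). max (d1 x1 y1) (d2 x2 y2))"

definition hyperbolic_product ::
    "'a set \<Rightarrow> 'b set \<Rightarrow> ('a \<Rightarrow> real) \<Rightarrow> ('b \<Rightarrow> real) \<Rightarrow> real \<Rightarrow> ('a \<times> 'b) set" where
  "hyperbolic_product M1 M2 B1 B2 \<Delta> = {(x1, x2) \<in> M1 \<times> M2. \<bar>B1 x1 - B2 x2\<bar> \<le> \<Delta>}"

end

theory Submission
  imports Defs
begin

text \<open>Along a rough geodesic ray \<open>\<gamma>\<close>, the quantity \<open>d x (\<gamma> t) - t\<close> eventually stays within a
  constant independent of \<open>x\<close> of the Busemann function \<open>B\<close>. Sending one of the four points of the
  hyperbolicity inequality to infinity along \<open>\<gamma>\<close> therefore shows that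
  \<open>\<rho> x y = d x y - B x - B y\<close> is a quasi-ultrametric:
  \<open>\<rho> x y \<le> max (\<rho> x z) (\<rho> z y) + C\<close>. On the hyperbolic product the two Busemann functions agree
  up to \<open>\<Delta>\<close>, so subtracting \<open>B\<^sub>1\<close> from the maximum metric gives, up to a constant, the maximum of two
  quasi-ultrametrics, which is again a quasi-ultrametric; and this property implies the four-point
  inequality, in which the subtracted terms cancel.\<close>

lemma Metric_space_max_dist:
  assumes "Metric_space M1 d1" "Metric_space M2 d2"
  shows "Metric_space (M1 \<times> M2) (max_dist d1 d2)"
proof -
  interpret A: Metric_space M1 d1 by fact
  interpret B: Metric_space M2 d2 by fact
  show ?thesis
  proof
    show "0 \<le> max_dist d1 d2 x y" for x y
      by (auto simp: max_dist_def split: prod.splits intro: max.coboundedI1)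
    show "max_dist d1 d2 x y = max_dist d1 d2 y x" for x y
      by (auto simp: max_dist_def A.commute B.commute split: prod.splits)
    show "max_dist d1 d2 x y = 0 \<longleftrightarrow> x = y" if "x \<in> M1 \<times> M2" "y \<in> M1 \<times> M2" for x y
    proof -
      obtain x1 x2 y1 y2 where xy: "x = (x1, x2)" "y = (y1, y2)"
        by (metis surj_pair)
      have "max (d1 x1 y1) (d2 x2 y2) = 0 \<longleftrightarrow> d1 x1 y1 = 0 \<and> d2 x2 y2 = 0"
        using A.nonneg[of x1 y1] B.nonneg[of x2 y2] by linarith
      then show ?thesis
        using that xy by (simp add: max_dist_def)
    qed
    show "max_dist d1 d2 x z \<le> max_dist d1 d2 x y + max_dist d1 d2 y z"
      if "x \<in> M1 \<times> M2" "y \<in> M1 \<times> M2" "z \<in> M1 \<times> M2" for x y z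
    proof -
      obtain x1 x2 y1 y2 z1 z2 where "x = (x1, x2)" "y = (y1, y2)" "z = (z1, z2)"
        by (metis surj_pair)
      with that A.triangle[of x1 y1 z1] B.triangle[of x2 y2 z2] show ?thesis
        by (auto simp: max_dist_def intro: order_trans add_mono)
    qed
  qed
qed

text \<open>For \<open>t \<ge> s\<close>, the upper bound is the triangle inequality through \<open>\<gamma> s\<close>. The lower bound is the
  four-point inequality for \<open>x, \<gamma> s, \<gamma> 0, \<gamma> t\<close>, where the other alternative of the maximum fails
  once \<open>s\<close> is large.\<close>

lemma busemann_approx:
  assumes "Metric_space M d" "delta_hyperbolic M d \<delta>" "rough_geodesic_ray M d \<gamma>"
  obtains K where "\<And>x. x \<in> M \<Longrightarrow> \<forall>\<^sub>F t in at_top. \<bar>d x (\<gamma> t) - t - busemann d \<gamma> x\<bar> \<le> K"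
proof -
  interpret Metric_space M d by fact
  obtain k where M: "\<And>t. t \<ge> 0 \<Longrightarrow> \<gamma> t \<in> M"
    and k: "\<And>s t. \<lbrakk>s \<ge> 0; t \<ge> 0\<rbrakk> \<Longrightarrow> \<bar>s - t\<bar> - k \<le> d (\<gamma> s) (\<gamma> t) \<and> d (\<gamma> s) (\<gamma> t) \<le> \<bar>s - t\<bar> + k"
    using assms(3) unfolding rough_geodesic_ray_def by (fastforce simp: Pi_iff)
  have k0: "k \<ge> 0"
    using k[of 0 0] by simp
  \<comment> \<open>One \<open>k\<close> is lost for each of
    \<open>d (\<gamma> 0) (\<gamma> t)\<close> and \<open>d (\<gamma> s) (\<gamma> 0)\<close>. Only
    the threshold for \<open>s\<close> depends on \<open>x\<close>, not \<open>K\<close>.\<close>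
  define K where "K = 2 * \<bar>\<delta>\<bar> + 2 * k"
  have "\<bar>d x (\<gamma> s) - s - busemann d \<gamma> x\<bar> \<le> K"
    if x: "x \<in> M" and s: "s \<ge> d x (\<gamma> 0) + K + 1" for x s
  proof -
    have s0: "s \<ge> 0"
      using s k0 nonneg[of x "\<gamma> 0"] unfolding K_def by linarith
    have near: "\<bar>(d x (\<gamma> s) - s) - (d x (\<gamma> t) - t)\<bar> \<le> K" if "t \<ge> s" for t
    proof -
      have t0: "t \<ge> 0" using s0 that by linarith
      have "d x (\<gamma> s) + d (\<gamma> 0) (\<gamma> t)
          \<le> max (d x (\<gamma> 0) + d (\<gamma> s) (\<gamma> t)) (d x (\<gamma> t) + d (\<gamma> s) (\<gamma> 0)) + 2 * \<delta>"
        using assms(2) x M s0 t0 unfolding delta_hyperbolic_def by simp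
      moreover have "d x (\<gamma> t) \<le> d x (\<gamma> s) + d (\<gamma> s) (\<gamma> t)"
        using triangle x M s0 t0 by blast
      moreover have "d (\<gamma> 0) (\<gamma> s) \<le> d x (\<gamma> 0) + d x (\<gamma> s)"
        using triangle[OF M[of 0] x M[OF s0]] commute[of x "\<gamma> 0"] by simp
      \<comment> \<open>If the maximum is its first term, the last triangle inequality gives
        \<open>2 * s \<le> 2 * d x (\<gamma> 0) + 3 * k + 2 * \<delta>\<close>, contrary to the
        choice of \<open>s\<close>.\<close>
      ultimately show ?thesis
        using k[OF s0 t0] k[of 0 t] k[of 0 s] s0 t0 that s k0 commute[of "\<gamma> 0" "\<gamma> s"]
        unfolding K_def by (smt (verit))
    qed
    \<comment> \<open>With \<open>s\<close> fixed, the two-sided bound passes to the lower limit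
      over \<open>t\<close>.\<close>
    let ?L = "Liminf at_top (\<lambda>t. ereal (d x (\<gamma> t) - t))"
    have ev: "\<forall>\<^sub>F t in at_top. \<bar>(d x (\<gamma> s) - s) - (d x (\<gamma> t) - t)\<bar> \<le> K"
      using eventually_ge_at_top[of s] by eventually_elim (rule near)
    have "ereal (d x (\<gamma> s) - s - K) \<le> ?L"
      by (rule Liminf_bounded, rule eventually_mono[OF ev]) auto
    moreover have "?L \<le> ereal (d x (\<gamma> s) - s + K)"
    proof -
      have "?L \<le> Limsup at_top (\<lambda>t. ereal (d x (\<gamma> t) - t))"
        by (rule Liminf_le_Limsup) simp
      also have "\<dots> \<le> ereal (d x (\<gamma> s) - s + K)"
        by (rule Limsup_bounded, rule eventually_mono[OF ev]) auto
      finally show ?thesis .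
    qed
    ultimately have "d x (\<gamma> s) - s - K \<le> busemann d \<gamma> x"
      and "busemann d \<gamma> x \<le> d x (\<gamma> s) - s + K"
      unfolding ereal_busemann[OF assms(1,3) x, symmetric] by simp_all
    then show ?thesis by linarith
  qed
  then have "\<forall>\<^sub>F t in at_top. \<bar>d x (\<gamma> t) - t - busemann d \<gamma> x\<bar> \<le> K" if "x \<in> M" for x
    using that eventually_at_top_linorder by blast
  then show thesis using that by blast
qed

text \<open>This is the quasi-ultrametric inequality for \<open>d x y - B x - B y\<close>, with
  \<open>B x + B y + B z\<close> added to both sides.\<close>

lemma busemann_quasi_ultrametric:
  assumes "gromov_hyperbolic M d" "rough_geodesic_ray M d \<gamma>"
  obtains C where "\<And>x y z. \<lbrakk>x \<in> M; y \<in> M; z \<in> M\<rbrakk> \<Longrightarrow>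
    d x y + busemann d \<gamma> z \<le> max (d x z + busemann d \<gamma> y) (d z y + busemann d \<gamma> x) + C"
proof -
  obtain \<delta> where ms: "Metric_space M d" and \<delta>: "delta_hyperbolic M d \<delta>"
    using assms(1) unfolding gromov_hyperbolic_def by blast
  interpret Metric_space M d by (rule ms)
  obtain K where K: "\<And>x. x \<in> M \<Longrightarrow> \<forall>\<^sub>F t in at_top. \<bar>d x (\<gamma> t) - t - busemann d \<gamma> x\<bar> \<le> K"
    using busemann_approx[OF ms \<delta> assms(2)] by blast
  have "d x y + busemann d \<gamma> z
      \<le> max (d x z + busemann d \<gamma> y) (d z y + busemann d \<gamma> x) + (2 * \<delta> + 2 * K)"
    if "x \<in> M" "y \<in> M" "z \<in> M" for x y z
  proof -
    have "\<forall>\<^sub>F t in at_top. \<bar>d x (\<gamma> t) - t - busemann d \<gamma> x\<bar> \<le> K \<and>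
        \<bar>d y (\<gamma> t) - t - busemann d \<gamma> y\<bar> \<le> K \<and> \<bar>d z (\<gamma> t) - t - busemann d \<gamma> z\<bar> \<le> K \<and> t \<ge> 0"
      using K that by (intro eventually_conj eventually_ge_at_top)
    then obtain t where t: "\<bar>d x (\<gamma> t) - t - busemann d \<gamma> x\<bar> \<le> K"
        "\<bar>d y (\<gamma> t) - t - busemann d \<gamma> y\<bar> \<le> K" "\<bar>d z (\<gamma> t) - t - busemann d \<gamma> z\<bar> \<le> K" "t \<ge> 0"
      by (metis (mono_tags, lifting) eventually_happens trivial_limit_at_top_linorder)
    have "\<gamma> t \<in> M"
      using assms(2) t(4) unfolding rough_geodesic_ray_def by (auto simp: Pi_iff)
    then have "d x y + d z (\<gamma> t) \<le> max (d x z + d y (\<gamma> t)) (d x (\<gamma> t) + d y z) + 2 * \<delta>"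
      using \<delta> that unfolding delta_hyperbolic_def by blast
    \<comment> \<open>Each alternative has one distance to \<open>\<gamma> t\<close> on either side:
      \<open>t\<close> cancels, and passing to Busemann values costs \<open>K\<close> twice.\<close>
    with t commute[of y z] show ?thesis
      by (smt (verit))
  qed
  then show thesis using that by blast
qed

text \<open>Up to \<open>C\<close>, each of \<open>r x y\<close> and \<open>r z w\<close> is bounded
  by one edge from each of its two triangles. Either a bound of \<open>r x y\<close> and a bound of
  \<open>r z w\<close> are opposite edges, and adding them suffices; or each value is bounded by
  both edges of an opposite pair, and doubling the larger value suffices.\<close>

lemma quasi_ultrametric_four_point:
  fixes r :: "'a \<Rightarrow> 'a \<Rightarrow> real"
  assumes sym: "\<And>x y. r x y = r y x"
    and um: "\<And>x y z. \<lbrakk>x \<in> M; y \<in> M; z \<in> M\<rbrakk> \<Longrightarrow> r x y \<le> max (r x z) (r z y) + C"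
    and M: "x \<in> M" "y \<in> M" "z \<in> M" "w \<in> M"
  shows "r x y + r z w \<le> max (r x z + r y w) (r x w + r y z) + 2 * C"
  using um[OF M(1,2,3)] um[OF M(1,2,4)] um[OF M(3,4,1)] um[OF M(3,4,2)]
    sym[of z x] sym[of z y] sym[of w y]
  by (smt (verit))

lemma gromov_hyperbolicI_quasi_ultrametric:
  fixes h :: "'a \<Rightarrow> real"
  assumes "Metric_space M d"
    and um: "\<And>x y z. \<lbrakk>x \<in> M; y \<in> M; z \<in> M\<rbrakk> \<Longrightarrow> d x y + h z \<le> max (d x z + h y) (d z y + h x) + C"
  shows "gromov_hyperbolic M d"
proof -
  interpret Metric_space M d by fact
  define r where "r x y = d x y - h x - h y" for x y
  have sym: "r x y = r y x" for x y
    by (simp add: r_def commute)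
  have um': "r x y \<le> max (r x z) (r z y) + C" if "x \<in> M" "y \<in> M" "z \<in> M" for x y z
    using um[OF that] unfolding r_def by linarith
  \<comment> \<open>Every point occurs once in each of the three sums, so all of them lose the same
    \<open>h x + h y + h z + h w\<close>. The absolute value makes the constant nonnegative.\<close>
  have "d x y + d z w \<le> max (d x z + d y w) (d x w + d y z) + 2 * \<bar>C\<bar>"
    if "x \<in> M" "y \<in> M" "z \<in> M" "w \<in> M" for x y z w
    using quasi_ultrametric_four_point[of r M C, OF sym um' that] unfolding r_def by linarith
  then have "delta_hyperbolic M d \<bar>C\<bar>"
    unfolding delta_hyperbolic_def by blast
  with assms(1) show ?thesis
    unfolding gromov_hyperbolic_def by (meson abs_ge_zero)
qed

theorem theorem3:
  fixes X1 :: "'a set" and d1 :: "'a \<Rightarrow> 'a \<Rightarrow> real" and z1 :: 'a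
    and X2 :: "'b set" and d2 :: "'b \<Rightarrow> 'b \<Rightarrow> real" and z2 :: 'b
    and u1 :: "(nat \<Rightarrow> 'a) set" and u2 :: "(nat \<Rightarrow> 'b) set"
    and \<gamma>1 :: "real \<Rightarrow> 'a" and \<gamma>2 :: "real \<Rightarrow> 'b"
  assumes "gromov_hyperbolic X1 d1" and "gromov_hyperbolic X2 d2"
    and "z1 \<in> X1" and "z2 \<in> X2"
    and "boundary_at_infinity X1 d1 z1 \<noteq> {}" and "boundary_at_infinity X2 d2 z2 \<noteq> {}"
    and "u1 \<in> boundary_at_infinity X1 d1 z1" and "u2 \<in> boundary_at_infinity X2 d2 z2"
    and "rough_geodesic_ray X1 d1 \<gamma>1" and "rough_geodesic_ray X2 d2 \<gamma>2"
    and "ray_converges_to X1 d1 z1 \<gamma>1 u1" and "ray_converges_to X2 d2 z2 \<gamma>2 u2"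
  shows "\<forall>\<Delta>\<ge>0. gromov_hyperbolic
           (hyperbolic_product X1 X2 (busemann d1 \<gamma>1) (busemann d2 \<gamma>2) \<Delta>) (max_dist d1 d2)"
proof (intro allI impI)
  fix \<Delta> :: real
  let ?B1 = "busemann d1 \<gamma>1" and ?B2 = "busemann d2 \<gamma>2"
  let ?Y = "hyperbolic_product X1 X2 ?B1 ?B2 \<Delta>"
  obtain C1 where C1: "\<And>x y z. \<lbrakk>x \<in> X1; y \<in> X1; z \<in> X1\<rbrakk> \<Longrightarrow>
      d1 x y + ?B1 z \<le> max (d1 x z + ?B1 y) (d1 z y + ?B1 x) + C1"
    using busemann_quasi_ultrametric[OF assms(1,9)] by blast
  obtain C2 where C2: "\<And>x y z. \<lbrakk>x \<in> X2; y \<in> X2; z \<in> X2\<rbrakk> \<Longrightarrow>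
      d2 x y + ?B2 z \<le> max (d2 x z + ?B2 y) (d2 z y + ?B2 x) + C2"
    using busemann_quasi_ultrametric[OF assms(2,10)] by blast
  have ms: "Metric_space ?Y (max_dist d1 d2)"
  proof (rule Metric_space.subspace)
    show "Metric_space (X1 \<times> X2) (max_dist d1 d2)"
      using assms(1,2) Metric_space_max_dist unfolding gromov_hyperbolic_def by blast
    show "?Y \<subseteq> X1 \<times> X2"
      by (auto simp: hyperbolic_product_def)
  qed
  show "gromov_hyperbolic ?Y (max_dist d1 d2)"
  proof (rule gromov_hyperbolicI_quasi_ultrametric[OF ms])
    fix x y z assume Y: "x \<in> ?Y" "y \<in> ?Y" "z \<in> ?Y"
    obtain x1 x2 y1 y2 z1 z2 where xyz: "x = (x1, x2)" "y = (y1, y2)" "z = (z1, z2)"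
      by (metis surj_pair)
    have mem: "x1 \<in> X1" "y1 \<in> X1" "z1 \<in> X1" "x2 \<in> X2" "y2 \<in> X2" "z2 \<in> X2"
      and \<Delta>: "\<bar>?B1 x1 - ?B2 x2\<bar> \<le> \<Delta>" "\<bar>?B1 y1 - ?B2 y2\<bar> \<le> \<Delta>" "\<bar>?B1 z1 - ?B2 z2\<bar> \<le> \<Delta>"
      using Y xyz by (auto simp: hyperbolic_product_def)
    have 1: "d1 x1 y1 + ?B1 z1 \<le> max (max (d1 x1 z1) (d2 x2 z2) + ?B1 y1)
        (max (d1 z1 y1) (d2 z2 y2) + ?B1 x1) + (\<bar>C1\<bar> + \<bar>C2\<bar> + 2 * \<bar>\<Delta>\<bar>)"
      using C1[OF mem(1-3)] by linarith
    \<comment> \<open>Replacing \<open>?B2\<close> by \<open>?B1\<close> costs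
      \<open>\<Delta>\<close> once on each side, hence
      \<open>2 * \<bar>\<Delta>\<bar>\<close>.\<close>
    have 2: "d2 x2 y2 + ?B1 z1 \<le> max (max (d1 x1 z1) (d2 x2 z2) + ?B1 y1)
        (max (d1 z1 y1) (d2 z2 y2) + ?B1 x1) + (\<bar>C1\<bar> + \<bar>C2\<bar> + 2 * \<bar>\<Delta>\<bar>)"
      using C2[OF mem(4-6)] \<Delta> by linarith
    \<comment> \<open>The function \<open>h\<close> is the first Busemann function composed with
      \<open>fst\<close>.\<close>
    show "max_dist d1 d2 x y + ?B1 (fst z) \<le> max (max_dist d1 d2 x z + ?B1 (fst y))
        (max_dist d1 d2 z y + ?B1 (fst x)) + (\<bar>C1\<bar> + \<bar>C2\<bar> + 2 * \<bar>\<Delta>\<bar>)"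
      using 1 2 unfolding xyz max_dist_def prod.case fst_conv by linarith
  qed
qed

end
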